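(* Let $H$ be a reflexive, compact valued, strongly surjective relation on a topological space $X$, and let $(B,d)$ be a complete metric space. Assume that $\varphi_1,\dots,\varphi_n\in\mathscr{C}(X,X)$ are such that $\varphi_k\circ H\subseteq H$ for all $k\in\{1,\dots,n\}$, and $F\in\mathscr{C}(X\times B^n,B)$ satisfies the Lipschitz condition $$d\bigl(F(t,x_1,\dots,x_n),F(t,y_1,\dots,y_n)\bigr)\le\sum_{k=1}^nL_k(t)\,d(x_k,y_k)$$ for all $t\in X$ and $x_k,y_k\in B$ ($k=1,\dots,n$), with continuous functions $L_k\colon X\to(0,+\infty)$. If there exists a positive function $\ell$ in $\mathscr{C}(X,\mathbb{R})$ satisfying $$\sum_{k=1}^nL_k(t)\,\ell\bigl(\varphi_k(t)\bigr)<\ell(t)$$ for all $t\in X$, then there exists a unique solution $f$ in $\mathscr{C}(X,B)$ of the Presić-type functional equation $$f(t)=F\bigl(t,f(\varphi_1(t)),\dots,f(\varphi_n(t))\bigr)\qquad(t\in X).$$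
   Context: $\mathscr{C}(X,Y)$ is the set of continuous maps from $X$ to $Y$; $n$ is a positive integer. A relation on $X$ is a subset $H\subseteq X^2$; it induces the set-valued map $H(t):=\{s\in X\mid (t,s)\in H\}$. $H$ is compact valued if $H(t)$ is compact for every $t\in X$. $H$ is strongly surjective if $\bigcup_{t\in X}H(t)^{\circ}=X$, where $^\circ$ denotes interior. For a map $\varphi\colon X\to X$, $\varphi\circ H:=\{(t,\varphi(s))\mid (t,s)\in H\}$, so $\varphi\circ H\subseteq H$ means $\varphi(H(t))\subseteq H(t)$ for all $t\in X$. *)

theory Defs
  imports "HOL-Analysis.Analysis"
begin

text \<open>
  A relation \<open>H\<close> on \<open>X\<close> is a set of pairs; its set-valued map is \<open>t \<mapsto> H `` {t}\<close>.
  The notion \<open>compact\<close> is the open-cover one; no separation axiom is involved.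
\<close>

definition compact_valued :: "('a::topological_space \<times> 'a) set \<Rightarrow> bool" where
  "compact_valued H \<longleftrightarrow> (\<forall>t. compact (H `` {t}))"

definition strongly_surjective :: "('a::topological_space \<times> 'a) set \<Rightarrow> bool" where
  "strongly_surjective H \<longleftrightarrow> (\<Union>t. interior (H `` {t})) = UNIV"

definition map_comp_rel :: "('a \<Rightarrow> 'a) \<Rightarrow> ('a \<times> 'a) set \<Rightarrow> ('a \<times> 'a) set" where
  "map_comp_rel \<phi> H = {(t, \<phi> s) | t s. (t, s) \<in> H}"

text \<open>
\<open>B\<^sup>n\<close> is rendered as \<open>'b ^ 'n\<close> with \<open>n = CARD('n) \<ge> 1\<close>, carrying the
  product topology.
\<close>

definition presic_solution ::
  "('a \<times> ('b ^ 'n) \<Rightarrow> 'b) \<Rightarrow> ('n::finite \<Rightarrow> 'a \<Rightarrow> 'a) \<Rightarrow> ('a \<Rightarrow> 'b) \<Rightarrow> bool" where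
  "presic_solution F \<phi> f \<longleftrightarrow> (\<forall>t. f t = F (t, \<chi> k. f (\<phi> k t)))"

end

theory Submission
  imports Defs
begin

text \<open>
  Let \<open>T f t = F (t, f (\<phi>\<^sub>1 t), \<dots>, f (\<phi>\<^sub>n t))\<close>. Each set \<open>K = H t\<close> is compact and invariant under
  all \<open>\<phi>\<^sub>k\<close>, so there is \<open>q < 1\<close> with \<open>\<Sum>\<^sub>k L\<^sub>k (l \<circ> \<phi>\<^sub>k) \<le> q l\<close> on \<open>K\<close>, and \<open>T\<close> contracts the
  \<open>l\<close>-weighted supremum distance over \<open>K\<close> by \<open>q\<close>. Hence the iterates of \<open>T\<close> on a constant map
  converge uniformly on every \<open>H t\<close>. Reflexivity of \<open>H\<close> yields a globally defined limit, and
  continuity follows because the interiors of the sets \<open>H t\<close> cover \<open>X\<close>.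
\<close>

definition presic_op ::
  "('a \<times> ('b ^ 'n) \<Rightarrow> 'b) \<Rightarrow> ('n::finite \<Rightarrow> 'a \<Rightarrow> 'a) \<Rightarrow> ('a \<Rightarrow> 'b) \<Rightarrow> 'a \<Rightarrow> 'b" where
  "presic_op F \<phi> f t = F (t, \<chi> k. f (\<phi> k t))"

lemma presic_solution_iff_fixpoint: "presic_solution F \<phi> f \<longleftrightarrow> presic_op F \<phi> f = f"
  unfolding presic_solution_def presic_op_def fun_eq_iff by metis

lemma continuous_on_presic_op:
  fixes F :: "'a::topological_space \<times> (('b::topological_space) ^ 'n::finite) \<Rightarrow> 'b"
  assumes "continuous_on UNIV F" "\<And>k. continuous_on UNIV (\<phi> k)" "continuous_on UNIV f"
  shows "continuous_on UNIV (presic_op F \<phi> f)"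
proof -
  have "continuous_on UNIV (\<lambda>t. f (\<phi> k t))" for k
    using continuous_on_compose2[OF assms(3) assms(2)] by simp
  then have "continuous_on UNIV (\<lambda>t. (t, \<chi> k. f (\<phi> k t)))"
    by (intro continuous_intros)
  then show ?thesis
    unfolding presic_op_def using continuous_on_compose2[OF assms(1)] by simp
qed

lemma continuous_on_presic_op_funpow:
  fixes F :: "'a::topological_space \<times> (('b::topological_space) ^ 'n::finite) \<Rightarrow> 'b"
  assumes "continuous_on UNIV F" "\<And>k. continuous_on UNIV (\<phi> k)" "continuous_on UNIV f"
  shows "continuous_on UNIV ((presic_op F \<phi> ^^ m) f)"
  by (induction m) (use assms in \<open>auto intro: continuous_on_presic_op\<close>)

text \<open>The quotient \<open>s / l\<close> attains its maximum on the compact set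
  \<open>K\<close>, and that maximum is below 1. A pointwise strict inequality thus yields one
  factor \<open>q < 1\<close> valid on all of \<open>K\<close>.\<close>

lemma compact_contraction_factor:
  fixes l s :: "'a::topological_space \<Rightarrow> real"
  assumes "compact K" "continuous_on K l" "continuous_on K s"
    and "\<And>t. t \<in> K \<Longrightarrow> 0 < l t" "\<And>t. t \<in> K \<Longrightarrow> s t < l t"
  obtains q where "0 \<le> q" "q < 1" "\<And>t. t \<in> K \<Longrightarrow> s t \<le> q * l t"
proof (cases "K = {}")
  case True
  then show ?thesis using that[of 0] by simp
next
  case False
  have "continuous_on K (\<lambda>t. s t / l t)"
    using assms(2-4) by (intro continuous_intros) force+
  then obtain x where x: "x \<in> K" "\<And>t. t \<in> K \<Longrightarrow> s t / l t \<le> s x / l x"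
    using continuous_attains_sup[OF assms(1) False] by blast
  show ?thesis
  \<comment> \<open>The function \<open>s\<close> may be negative, so the maximum with 0 secures
    \<open>0 \<le> q\<close>.\<close>
  proof (rule that[of "max 0 (s x / l x)"])
    show "max 0 (s x / l x) < 1"
      using assms(4,5)[OF x(1)] by simp
    show "s t \<le> max 0 (s x / l x) * l t" if "t \<in> K" for t
      using x(2)[OF that] assms(4)[OF that]
      by (metis le_max_iff_disj pos_divide_le_eq)
  qed simp
qed

text \<open>Continuous maps have finite \<open>l\<close>-weighted distance over a compact set, again
  by attaining a maximum. The constant \<open>C\<close> starts the contraction estimates.\<close>

lemma compact_dist_le_weight:
  fixes f g :: "'a::topological_space \<Rightarrow> 'b::metric_space" and l :: "'a \<Rightarrow> real"
  assumes "compact K" "continuous_on K l" "continuous_on K f" "continuous_on K g"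
    and "\<And>t. t \<in> K \<Longrightarrow> 0 < l t"
  obtains C where "0 \<le> C" "\<And>t. t \<in> K \<Longrightarrow> dist (f t) (g t) \<le> C * l t"
proof (cases "K = {}")
  case True
  then show ?thesis using that[of 0] by simp
next
  case False
  have "continuous_on K (\<lambda>t. dist (f t) (g t) / l t)"
    using assms(2-5) by (intro continuous_intros) force+
  then obtain x where
    x: "x \<in> K" "\<And>t. t \<in> K \<Longrightarrow> dist (f t) (g t) / l t \<le> dist (f x) (g x) / l x"
    using continuous_attains_sup[OF assms(1) False] by blast
  show ?thesis
  proof (rule that)
    show "0 \<le> dist (f x) (g x) / l x"
      using assms(5)[OF x(1)] by simp
    show "dist (f t) (g t) \<le> dist (f x) (g x) / l x * l t" if "t \<in> K" for t
      using x(2)[OF that] assms(5)[OF that] by (metis pos_divide_le_eq)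
  qed
qed

text \<open>All assumptions concern points of one compact invariant set, so that \<open>K\<close>
  can later be any \<open>H t\<close>, with a factor \<open>q\<close> that depends on
  \<open>t\<close>.\<close>

locale presic_contraction =
  fixes K :: "'a::topological_space set"
    and \<phi> :: "'n::finite \<Rightarrow> 'a \<Rightarrow> 'a"
    and F :: "'a \<times> (('b::metric_space) ^ 'n) \<Rightarrow> 'b"
    and L :: "'n \<Rightarrow> 'a \<Rightarrow> real"
    and l :: "'a \<Rightarrow> real"
    and q :: real
  assumes compact: "compact K"
    and invariant: "t \<in> K \<Longrightarrow> \<phi> k t \<in> K"
    and L_nonneg: "t \<in> K \<Longrightarrow> 0 \<le> L k t"
    and lipschitz: "t \<in> K \<Longrightarrow>
      dist (F (t, x)) (F (t, y)) \<le> (\<Sum>k\<in>UNIV. L k t * dist (x $ k) (y $ k))"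
    and l_pos: "t \<in> K \<Longrightarrow> 0 < l t"
    and l_continuous: "continuous_on K l"
    and q: "0 \<le> q" "q < 1"
    and weight: "t \<in> K \<Longrightarrow> (\<Sum>k\<in>UNIV. L k t * l (\<phi> k t)) \<le> q * l t"
begin

text \<open>The contraction property for the weighted distance, phrased through a bound
  \<open>C\<close> instead of a supremum. Invariance allows the bound to be used at each
  \<open>\<phi> k t\<close>, and \<open>weight\<close> absorbs the resulting sum into
  \<open>q * l t\<close>.\<close>

lemma dist_presic_op_le:
  assumes "0 \<le> C" "\<And>t. t \<in> K \<Longrightarrow> dist (f t) (g t) \<le> C * l t" "t \<in> K"
  shows "dist (presic_op F \<phi> f t) (presic_op F \<phi> g t) \<le> q * C * l t"
proof -
  have "dist (presic_op F \<phi> f t) (presic_op F \<phi> g t)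
      \<le> (\<Sum>k\<in>UNIV. L k t * dist (f (\<phi> k t)) (g (\<phi> k t)))"
    using lipschitz[OF assms(3), of "\<chi> k. f (\<phi> k t)" "\<chi> k. g (\<phi> k t)"]
    by (simp add: presic_op_def)
  also have "\<dots> \<le> (\<Sum>k\<in>UNIV. L k t * (C * l (\<phi> k t)))"
    by (intro sum_mono mult_left_mono assms(2) invariant L_nonneg assms(3))
  also have "\<dots> = C * (\<Sum>k\<in>UNIV. L k t * l (\<phi> k t))"
    by (simp add: sum_distrib_left mult.left_commute)
  also have "\<dots> \<le> C * (q * l t)"
    by (intro mult_left_mono weight assms)
  finally show ?thesis
    by (simp add: mult_ac)
qed

lemma dist_presic_op_funpow_le:
  assumes "0 \<le> C" "\<And>t. t \<in> K \<Longrightarrow> dist (f t) (g t) \<le> C * l t" "t \<in> K"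
  shows "dist ((presic_op F \<phi> ^^ m) f t) ((presic_op F \<phi> ^^ m) g t) \<le> q ^ m * C * l t"
  using assms(3)
proof (induction m arbitrary: t)
  case 0
  then show ?case using assms(2) by simp
next
  case (Suc m)
  have "0 \<le> q ^ m * C" using q assms(1) by simp
  from dist_presic_op_le[OF this Suc.IH Suc.prems] show ?case
    by (simp add: mult_ac)
qed

text \<open>Iterating fixes both maps but shrinks the bound on their distance to
  \<open>q ^ m * C * l t\<close>, which tends to 0.\<close>

lemma fixpoints_eq:
  assumes "continuous_on K f" "continuous_on K g"
    and "presic_op F \<phi> f = f" "presic_op F \<phi> g = g" and "t \<in> K"
  shows "f t = g t"
proof -
  obtain C where C: "0 \<le> C" "\<And>t. t \<in> K \<Longrightarrow> dist (f t) (g t) \<le> C * l t"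
    using compact_dist_le_weight[OF compact l_continuous assms(1,2) l_pos] by blast
  have fixes_funpow: "(presic_op F \<phi> ^^ m) h = h" if "presic_op F \<phi> h = h" for m h
    by (induction m) (simp_all add: that)
  have "dist (f t) (g t) \<le> q ^ m * C * l t" for m
    using dist_presic_op_funpow_le[OF C assms(5), of m] fixes_funpow assms(3,4) by simp
  moreover have "(\<lambda>m. q ^ m * C * l t) \<longlonglongrightarrow> 0 * C * l t"
    by (intro tendsto_intros LIMSEQ_power_zero) (use q in auto)
  ultimately have "dist (f t) (g t) \<le> 0"
    by (intro LIMSEQ_le_const[of "\<lambda>m. q ^ m * C * l t"]) auto
  then show ?thesis by simp
qed

text \<open>\<open>C / (1 - q)\<close> is the sum of the geometric series with first term
  \<open>C\<close>. It solves \<open>D = C + q * D\<close>, which closes the induction and gives a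
  bound independent of \<open>j\<close>.\<close>

lemma dist_funpow_initial_le:
  assumes "0 \<le> C" "\<And>t. t \<in> K \<Longrightarrow> dist (f t) (presic_op F \<phi> f t) \<le> C * l t" "t \<in> K"
  shows "dist (f t) ((presic_op F \<phi> ^^ j) f t) \<le> C / (1 - q) * l t"
  using assms(3)
proof (induction j arbitrary: t)
  case 0
  then show ?case using q assms(1) l_pos[of t] by simp
next
  case (Suc j)
  have "0 \<le> C / (1 - q)" using q assms(1) by simp
  \<comment> \<open>The triangle inequality goes through \<open>presic_op F \<phi> f t\<close>: the
    first distance is bounded by assumption, the second by contracting the induction hypothesis
    once.\<close>
  from dist_presic_op_le[OF this Suc.IH Suc.prems]
  have "dist (f t) ((presic_op F \<phi> ^^ Suc j) f t) \<le> C * l t + q * (C / (1 - q)) * l t"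
    using dist_triangle[of "f t" "(presic_op F \<phi> ^^ Suc j) f t" "presic_op F \<phi> f t"]
      assms(2)[OF Suc.prems] by simp
  also have "\<dots> = C / (1 - q) * l t"
    using q by (simp add: field_simps)
  finally show ?case .
qed

lemma uniformly_Cauchy_on_funpow:
  assumes "continuous_on K f" "continuous_on K (presic_op F \<phi> f)"
  shows "uniformly_Cauchy_on K (\<lambda>m. (presic_op F \<phi> ^^ m) f)"
proof (rule uniformly_Cauchy_onI')
  fix e :: real assume e: "e > 0"
  let ?T = "presic_op F \<phi>"
  obtain C where C: "0 \<le> C" "\<And>t. t \<in> K \<Longrightarrow> dist (f t) (?T f t) \<le> C * l t"
    using compact_dist_le_weight[OF compact l_continuous assms l_pos] by blast
  \<comment> \<open>An upper bound \<open>M\<close> of \<open>l\<close> on \<open>K\<close> turns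
    weighted estimates into uniform ones.\<close>
  have "bounded (l ` K)"
    using compact_continuous_image[OF l_continuous compact] by (rule compact_imp_bounded)
  then obtain M where M: "M > 0" "\<And>t. t \<in> K \<Longrightarrow> l t \<le> M"
    unfolding bounded_pos by force
  define D where "D = C / (1 - q)"
  have D: "0 \<le> D" using C q by (simp add: D_def)
  have "(\<lambda>m. q ^ m * D * M) \<longlonglongrightarrow> 0 * D * M"
    by (intro tendsto_intros LIMSEQ_power_zero) (use q in auto)
  then have "\<forall>\<^sub>F m in sequentially. q ^ m * D * M < e"
    using e by (intro order_tendstoD) auto
  then obtain N where N: "\<And>m. m \<ge> N \<Longrightarrow> q ^ m * D * M < e"
    unfolding eventually_sequentially by blast
  have "dist ((?T ^^ m) f t) ((?T ^^ n) f t) < e" if "t \<in> K" "m \<ge> N" "n > m" for t m n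
  proof -
    \<comment> \<open>Both iterates are \<open>?T ^^ m\<close> applied to maps at weighted distance
      at most \<open>D\<close>, whatever \<open>n - m\<close> is.\<close>
    have "(?T ^^ n) f = (?T ^^ m) ((?T ^^ (n - m)) f)"
      using that(3) by (metis comp_apply funpow_add le_add_diff_inverse less_imp_le)
    then have "dist ((?T ^^ m) f t) ((?T ^^ n) f t) \<le> q ^ m * D * l t"
      using dist_presic_op_funpow_le[OF D dist_funpow_initial_le[OF C, folded D_def] that(1)]
      by simp
    also have "\<dots> \<le> q ^ m * D * M"
      using D q M(2)[OF that(1)] by (intro mult_left_mono) auto
    finally show ?thesis using N[OF that(2)] by simp
  qed
  then show "\<exists>N. \<forall>t\<in>K. \<forall>m\<ge>N. \<forall>n>m. dist ((?T ^^ m) f t) ((?T ^^ n) f t) < e"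
    by blast
qed

end

theorem theorem6:
  fixes H :: "('a::topological_space \<times> 'a) set"
    and \<phi> :: "'n::finite \<Rightarrow> 'a \<Rightarrow> 'a"
    and F :: "'a \<times> (('b::complete_space) ^ 'n) \<Rightarrow> 'b"
    and L :: "'n \<Rightarrow> 'a \<Rightarrow> real"
  assumes "refl H" and "compact_valued H" and "strongly_surjective H"
    and "\<And>k. continuous_on UNIV (\<phi> k)"
    and "\<And>k. map_comp_rel (\<phi> k) H \<subseteq> H"
    and "continuous_on UNIV F"
    and "\<And>k. continuous_on UNIV (L k)" and "\<And>k t. 0 < L k t"
    and "\<And>t x y. dist (F (t, x)) (F (t, y)) \<le> (\<Sum>k\<in>UNIV. L k t * dist (x $ k) (y $ k))"
    and "\<exists>l :: 'a \<Rightarrow> real. continuous_on UNIV l \<and> (\<forall>t. 0 < l t) \<and>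
           (\<forall>t. (\<Sum>k\<in>UNIV. L k t * l (\<phi> k t)) < l t)"
  shows "\<exists>!f. continuous_on UNIV f \<and> presic_solution F \<phi> f"
proof -
  obtain l :: "'a \<Rightarrow> real" where l: "continuous_on UNIV l" "\<And>t. 0 < l t"
      "\<And>t. (\<Sum>k\<in>UNIV. L k t * l (\<phi> k t)) < l t"
    using assms(10) by blast
  have l_\<phi>: "continuous_on UNIV (\<lambda>t. l (\<phi> k t))" for k
    using continuous_on_compose2[OF l(1) assms(4)] by simp
  have contraction: "\<exists>q. presic_contraction (H `` {p}) \<phi> F L l q" for p
  proof -
    have K: "compact (H `` {p})"
      using assms(2) by (simp add: compact_valued_def)
    have l_K: "continuous_on (H `` {p}) l"
      using l(1) continuous_on_subset by blast
    have "continuous_on UNIV (\<lambda>t. \<Sum>k\<in>UNIV. L k t * l (\<phi> k t))"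
      by (intro continuous_intros assms(7) l_\<phi>)
    then have "continuous_on (H `` {p}) (\<lambda>t. \<Sum>k\<in>UNIV. L k t * l (\<phi> k t))"
      using continuous_on_subset by blast
    then obtain q where q: "0 \<le> q" "q < 1"
        "\<And>t. t \<in> H `` {p} \<Longrightarrow> (\<Sum>k\<in>UNIV. L k t * l (\<phi> k t)) \<le> q * l t"
      using compact_contraction_factor[OF K l_K _ l(2,3)] by blast
    have "\<phi> k t \<in> H `` {p}" if "t \<in> H `` {p}" for k t
      using that assms(5)[of k] by (auto simp: map_comp_rel_def)
    then have "presic_contraction (H `` {p}) \<phi> F L l q"
      using K l_K l(2) q assms(9) less_imp_le[OF assms(8)] by unfold_locales auto
    then show ?thesis ..
  qed
  have mem: "t \<in> H `` {t}" for t
    using assms(1) by (simp add: refl_on_def)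
  \<comment> \<open>Here \<open>undefined\<close> merely names some element of \<open>B\<close>; the
    iteration starts at a constant, hence continuous, map.\<close>
  define u where "u m = (presic_op F \<phi> ^^ m) (\<lambda>_. undefined)" for m
  have u_cont: "continuous_on UNIV (u m)" for m
    unfolding u_def by (intro continuous_on_presic_op_funpow assms(4,6) continuous_on_const)
  have u_Suc: "u (Suc m) t = F (t, \<chi> k. u m (\<phi> k t))" for m t
    by (simp add: u_def presic_op_def)
  have Cauchy: "uniformly_Cauchy_on (H `` {p}) u" for p
  proof -
    obtain q where "presic_contraction (H `` {p}) \<phi> F L l q"
      using contraction by blast
    then interpret presic_contraction "H `` {p}" \<phi> F L l q .
    have "continuous_on UNIV (presic_op F \<phi> (\<lambda>_. undefined))"
      by (intro continuous_on_presic_op assms(4,6) continuous_on_const)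
    then show ?thesis
      unfolding u_def
      using uniformly_Cauchy_on_funpow continuous_on_subset[OF _ subset_UNIV]
        continuous_on_const by blast
  qed
  define f where "f t = lim (\<lambda>m. u m t)" for t
  have unif: "uniform_limit (H `` {p}) u f sequentially" for p
    using Cauchy_uniformly_convergent[OF Cauchy[of p]]
    unfolding uniformly_convergent_uniform_limit_iff f_def .
  have lim: "(\<lambda>m. u m t) \<longlonglongrightarrow> f t" for t
    using tendsto_uniform_limitI[OF unif mem] .
  have f_cont: "continuous_on UNIV f"
  proof -
    have "continuous_on (interior (H `` {p})) f" for p
    proof -
      have "continuous_on (H `` {p}) f"
        using uniform_limit_theorem[OF _ unif[of p]] continuous_on_subset[OF u_cont subset_UNIV]
        by simp
      then show ?thesis
        using continuous_on_subset interior_subset by blast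
    qed
    then have "continuous_on (\<Union>p. interior (H `` {p})) f"
      by (intro continuous_on_open_UN) auto
    then show ?thesis
      using assms(3) by (simp add: strongly_surjective_def)
  qed
  have f_sol: "presic_solution F \<phi> f"
    unfolding presic_solution_def
  proof
    fix t
    \<comment> \<open>Pointwise convergence at the finitely many points \<open>\<phi> k t\<close>
      and continuity of \<open>F\<close> let the recursion for \<open>u (Suc m) t\<close> pass to
      the limit.\<close>
    have "(\<lambda>m. (t, \<chi> k. u m (\<phi> k t))) \<longlonglongrightarrow> (t, \<chi> k. f (\<phi> k t))"
      by (intro tendsto_intros lim)
    then have "(\<lambda>m. u (Suc m) t) \<longlonglongrightarrow> F (t, \<chi> k. f (\<phi> k t))"
      unfolding u_Suc using continuous_on_tendsto_compose[OF assms(6)] by simp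
    then show "f t = F (t, \<chi> k. f (\<phi> k t))"
      using LIMSEQ_unique LIMSEQ_Suc[OF lim] by blast
  qed
  have "g = f" if "continuous_on UNIV g" "presic_solution F \<phi> g" for g
  proof
    fix t
    obtain q where "presic_contraction (H `` {t}) \<phi> F L l q"
      using contraction by blast
    then interpret presic_contraction "H `` {t}" \<phi> F L l q .
    show "g t = f t"
      using fixpoints_eq[of g f t] mem that f_cont f_sol continuous_on_subset[OF _ subset_UNIV]
      unfolding presic_solution_iff_fixpoint by blast
  qed
  then show ?thesis
    using f_cont f_sol by blast
qed

end
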